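(* Let $N\geq 1$, $p>1$, let $L(x,\nabla)$ be a linear differential operator on $\mathbb{R}^N$ of order $m$, and let $f\in L^\infty_{\mathrm{loc}}(\mathbb{R}^N)$ with $f(x)>0$ a.e. Assume there exists $g$ with $g(x)>0$ a.e. such that, setting $D=gL$, the formal adjoint $D^*$ is a differential operator with $L^\infty_{\mathrm{loc}}$ coefficients and no zero order term, i.e. \[ D^*(x,\nabla)=\sum_{1\leq|\alpha|\leq m}a_\alpha(x)\partial_x^\alpha,\qquad a_\alpha\in L^\infty_{\mathrm{loc}}(\mathbb{R}^N). \] Let $u\in L^1_{\mathrm{loc}}(\mathbb{R}^N)$ with $fg|u|^p\in L^1_{\mathrm{loc}}(\mathbb{R}^N)$ be a global $g$-solution of $Lu=f|u|^p$, i.e. \[ \int_{\mathbb{R}^N}f(x)g(x)|u(x)|^p\phi(x)\,dx=\int_{\mathbb{R}^N}u(x)\,D^*(x,\nabla)\phi(x)\,dx\qquad\text{for all }\phi\in\mathcal{C}^\infty_c(\mathbb{R}^N). \] Suppose there exist strictly increasing continuous functions $F_i:(0,\infty)\to(0,\infty)$, $i=1,\dots,N$, with $F_i(R)\to\infty$ as $R\to\infty$, such that \[ \limsup_{R\to\infty}H_\alpha(R)\,G_\alpha(R)^{1/p'}<\infty\qquad\text{for every }1\leq|\alpha|\leq m, \] where $p'=p/(p-1)$, \[ H_\alpha(R)=\prod_{i=1}^NF_i(R)^{-\alpha_i},\qquad G_\alpha(R)=\int_{Q_R^{(\alpha)}}|a_\alpha(x)|^{p'}\,(g(x)f(x))^{-(p'-1)}\,dx\in[0,\infty],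 \] and $Q_R^{(\alpha)}=\{x\in\mathbb{R}^N:\ |x_i|\leq F_i(R)\ \forall i,\ \ |x_i|\geq F_i(R)/2\text{ for every }i\text{ with }\alpha_i\neq0\}$. Then $u(x)=0$ a.e.
   Context: The formal adjoint $D^*$ of a differential operator $D$ is defined by $\int vDu\,dx=\int u D^*v\,dx$ for all $u,v\in\mathcal{C}^\infty_c(\mathbb{R}^N)$. *)

theory Defs
  imports "HOL-Analysis.Analysis"
begin

definition pderiv_dir :: "'n::finite \<Rightarrow> (real^'n \<Rightarrow> real) \<Rightarrow> real^'n \<Rightarrow> real" where
  "pderiv_dir i \<phi> x = deriv (\<lambda>t. \<phi> (x + t *\<^sub>R axis i 1)) 0"

fun pderiv_list :: "'n::finite list \<Rightarrow> (real^'n \<Rightarrow> real) \<Rightarrow> real^'n \<Rightarrow> real" where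
  "pderiv_list [] \<phi> = \<phi>"
| "pderiv_list (i # is) \<phi> = pderiv_dir i (pderiv_list is \<phi>)"

definition mi_order :: "('n::finite \<Rightarrow> nat) \<Rightarrow> nat" where
  "mi_order \<alpha> = (\<Sum>i\<in>UNIV. \<alpha> i)"

(* \<partial>^alpha: differentiate alpha i times in direction i (order irrelevant for smooth phi) *)
definition pderiv_mi :: "('n::finite \<Rightarrow> nat) \<Rightarrow> (real^'n \<Rightarrow> real) \<Rightarrow> real^'n \<Rightarrow> real" where
  "pderiv_mi \<alpha> \<phi> = pderiv_list (SOME is. \<forall>i. count_list is i = \<alpha> i) \<phi>"

definition smooth_fun :: "(real^'n::finite \<Rightarrow> real) \<Rightarrow> bool" where
  "smooth_fun \<phi> \<longleftrightarrow> (\<forall>is. pderiv_list is \<phi> differentiable_on UNIV)"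

definition test_fun :: "(real^'n::finite \<Rightarrow> real) \<Rightarrow> bool" where
  "test_fun \<phi> \<longleftrightarrow> smooth_fun \<phi> \<and> (\<exists>K. compact K \<and> (\<forall>x. x \<notin> K \<longrightarrow> \<phi> x = 0))"

definition L1_loc :: "(real^'n::finite \<Rightarrow> real) \<Rightarrow> bool" where
  "L1_loc u \<longleftrightarrow> u \<in> borel_measurable lebesgue \<and>
     (\<forall>K. compact K \<longrightarrow> set_integrable lebesgue K u)"

definition Linf_loc :: "(real^'n::finite \<Rightarrow> real) \<Rightarrow> bool" where
  "Linf_loc u \<longleftrightarrow> u \<in> borel_measurable lebesgue \<and>
     (\<forall>K. compact K \<longrightarrow> (\<exists>C. AE x in lebesgue. x \<in> K \<longrightarrow> \<bar>u x\<bar> \<le> C))"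

(* power of an element of [0,\<infinity>] with positive real exponent, \<infinity>^r = \<infinity> *)
definition enn_powr :: "ennreal \<Rightarrow> real \<Rightarrow> ennreal" where
  "enn_powr G r = (if G = \<infinity> then \<infinity> else ennreal (enn2real G powr r))"

definition Q_set :: "('n::finite \<Rightarrow> real \<Rightarrow> real) \<Rightarrow> ('n \<Rightarrow> nat) \<Rightarrow> real \<Rightarrow> (real^'n) set" where
  "Q_set F \<alpha> R = {x. \<forall>i. \<bar>x $ i\<bar> \<le> F i R \<and> (\<alpha> i \<noteq> 0 \<longrightarrow> \<bar>x $ i\<bar> \<ge> F i R / 2)}"

definition H_fun :: "('n::finite \<Rightarrow> real \<Rightarrow> real) \<Rightarrow> ('n \<Rightarrow> nat) \<Rightarrow> real \<Rightarrow> real" where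
  "H_fun F \<alpha> R = (\<Prod>i\<in>UNIV. F i R powr (- real (\<alpha> i)))"

definition G_fun :: "('n::finite \<Rightarrow> real \<Rightarrow> real) \<Rightarrow> real \<Rightarrow> (real^'n \<Rightarrow> real) \<Rightarrow> (real^'n \<Rightarrow> real)
    \<Rightarrow> (real^'n \<Rightarrow> real) \<Rightarrow> ('n \<Rightarrow> nat) \<Rightarrow> real \<Rightarrow> ennreal" where
  "G_fun F p' a g f \<alpha> R = (\<integral>\<^sup>+ x \<in> Q_set F \<alpha> R.
      ennreal (\<bar>a x\<bar> powr p' * (g x * f x) powr (- (p' - 1))) \<partial>lebesgue)"

end

theory Submission
  imports Defs
begin

text \<open>
  Put \<open>v = f g |u|\<^sup>p\<close> and test with \<open>\<phi>\<^sub>R(x) = \<Prod>\<^sub>i \<eta>(x\<^sub>i / F\<^sub>i(R))\<close>, where \<open>\<eta>\<close> is a high power of a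
  smooth plateau function. Taking a power gives \<open>|\<eta>\<^sup>(\<^sup>j\<^sup>)| \<le> C \<eta>\<^sup>1\<^sup>/\<^sup>p\<close> for \<open>j \<le> m\<close>, hence
  \<open>|\<partial>\<^sup>\<alpha>\<phi>\<^sub>R| \<le> C H\<^sub>\<alpha>(R) \<phi>\<^sub>R\<^sup>1\<^sup>/\<^sup>p\<close>, with support in the set \<open>Q\<close> belonging to \<open>\<alpha>\<close> and \<open>R\<close>. Young's
  inequality with a free parameter \<open>s > 0\<close> and the growth hypothesis then yield, for large \<open>R\<close>,
  \<open>\<integral> v \<phi>\<^sub>R \<le> s \<Sum>\<^sub>\<alpha> \<integral>\<^sub>Q v \<phi>\<^sub>R + s\<^sup>1\<^sup>-\<^sup>p\<^sup>' B\<close> with \<open>B\<close> independent of \<open>R\<close> and \<open>s\<close>. For small \<open>s\<close> the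
  sum is absorbed on the left, so \<open>v\<close> is integrable. Since every \<open>\<alpha>\<close> is nonzero, the sets \<open>Q\<close>
  escape to infinity, so letting first \<open>R\<close> and then \<open>s\<close> tend to infinity gives \<open>\<integral> v = 0\<close>.
\<close>

section \<open>Smooth functions of one real variable\<close>

text \<open>The recursion asks for an explicit derivative function. Closure under the usual
  operations then follows by induction on the order: the classical derivative formula is the
  witness, and the induction hypothesis is applied to its parts.\<close>

primrec k_times_differentiable :: "nat \<Rightarrow> (real \<Rightarrow> real) \<Rightarrow> bool" where
  "k_times_differentiable 0 h \<longleftrightarrow> True"
| "k_times_differentiable (Suc k) h \<longleftrightarrow>
     (\<exists>h'. (\<forall>x. (h has_real_derivative h' x) (at x)) \<and> k_times_differentiable k h')"

definition smooth_real :: "(real \<Rightarrow> real) \<Rightarrow> bool" where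
  "smooth_real h \<longleftrightarrow> (\<forall>k. k_times_differentiable k h)"

lemma k_times_differentiable_SucD: "k_times_differentiable (Suc k) h \<Longrightarrow> k_times_differentiable k h"
proof (induction k arbitrary: h)
  case (Suc k)
  then obtain h' where "\<forall>x. (h has_real_derivative h' x) (at x)" "k_times_differentiable (Suc k) h'"
    by (auto simp only: k_times_differentiable.simps)
  with Suc.IH show ?case by auto
qed simp

lemma k_times_differentiable_const: "k_times_differentiable k (\<lambda>_. c)"
proof (induction k arbitrary: c)
  case (Suc k)
  show ?case using Suc[of 0] by (auto intro!: exI[of _ "\<lambda>_. 0"])
qed simp

lemma k_times_differentiable_add:
  "k_times_differentiable k f \<Longrightarrow> k_times_differentiable k g \<Longrightarrow> k_times_differentiable k (\<lambda>x. f x + g x)"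
proof (induction k arbitrary: f g)
  case (Suc k)
  then obtain f' g' where "\<forall>x. (f has_real_derivative f' x) (at x)" "k_times_differentiable k f'"
     "\<forall>x. (g has_real_derivative g' x) (at x)" "k_times_differentiable k g'" by auto
  with Suc.IH[of f' g'] show ?case
    by (auto intro!: exI[of _ "\<lambda>x. f' x + g' x"] derivative_intros)
qed simp

text \<open>The product rule contains \<open>f\<close> and \<open>g\<close> themselves next to
  \<open>f'\<close> and \<open>g'\<close>; \<open>k_times_differentiable_SucD\<close> lowers their
  order to \<open>k\<close> so that the induction hypothesis covers all four.\<close>

lemma k_times_differentiable_mult:
  "k_times_differentiable k f \<Longrightarrow> k_times_differentiable k g \<Longrightarrow> k_times_differentiable k (\<lambda>x. f x * g x)"
proof (induction k arbitrary: f g)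
  case (Suc k)
  note fg = Suc.prems[THEN k_times_differentiable_SucD]
  from Suc obtain f' g' where D: "\<forall>x. (f has_real_derivative f' x) (at x)" "k_times_differentiable k f'"
     "\<forall>x. (g has_real_derivative g' x) (at x)" "k_times_differentiable k g'" by auto
  have "k_times_differentiable k (\<lambda>x. f' x * g x + g' x * f x)"
    using Suc.IH fg D by (intro k_times_differentiable_add) auto
  with D show ?case
    by (auto intro!: exI[of _ "\<lambda>x. f' x * g x + g' x * f x"] DERIV_mult)
qed simp

lemma k_times_differentiable_compose:
  "k_times_differentiable k f \<Longrightarrow> k_times_differentiable k g \<Longrightarrow> k_times_differentiable k (\<lambda>x. f (g x))"
proof (induction k arbitrary: f g)
  case (Suc k)
  from Suc obtain f' g' where D: "\<forall>x. (f has_real_derivative f' x) (at x)" "k_times_differentiable k f'"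
     "\<forall>x. (g has_real_derivative g' x) (at x)" "k_times_differentiable k g'" by auto
  have "k_times_differentiable k (\<lambda>x. f' (g x) * g' x)"
    using Suc.IH[OF D(2)] Suc.prems(2)[THEN k_times_differentiable_SucD] D
    by (intro k_times_differentiable_mult) auto
  with D show ?case
    unfolding k_times_differentiable.simps
    by (intro exI[of _ "\<lambda>x. f' (g x) * g' x"] conjI allI DERIV_chain2[of f]) auto
qed simp

lemma k_times_differentiable_inverse:
  "k_times_differentiable k f \<Longrightarrow> (\<And>x. f x \<noteq> 0) \<Longrightarrow> k_times_differentiable k (\<lambda>x. inverse (f x))"
proof (induction k arbitrary: f)
  case (Suc k)
  from Suc obtain f' where D: "\<forall>x. (f has_real_derivative f' x) (at x)" "k_times_differentiable k f'"
    by auto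
  have I: "k_times_differentiable k (\<lambda>x. inverse (f x))"
    using Suc.IH[OF k_times_differentiable_SucD[OF Suc.prems(1)]] Suc.prems by auto
  have "k_times_differentiable k (\<lambda>x. (-1) * (f' x * (inverse (f x) * inverse (f x))))"
    by (intro k_times_differentiable_mult k_times_differentiable_const I D)
  with D Suc.prems(2) show ?case
    by (auto intro!: exI[of _ "\<lambda>x. (-1) * (f' x * (inverse (f x) * inverse (f x)))"] derivative_eq_intros)
qed simp

lemma k_times_differentiable_ident: "k_times_differentiable k (\<lambda>x. x)"
  by (cases k) (auto intro!: exI[of _ "\<lambda>_. 1"] k_times_differentiable_const)

lemma smooth_real_ident: "smooth_real (\<lambda>x. x)"
  and smooth_real_const: "smooth_real (\<lambda>_. c)"
  by (simp_all add: smooth_real_def k_times_differentiable_ident k_times_differentiable_const)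

lemma smooth_real_add: "smooth_real f \<Longrightarrow> smooth_real g \<Longrightarrow> smooth_real (\<lambda>x. f x + g x)"
  and smooth_real_mult: "smooth_real f \<Longrightarrow> smooth_real g \<Longrightarrow> smooth_real (\<lambda>x. f x * g x)"
  and smooth_real_compose: "smooth_real f \<Longrightarrow> smooth_real g \<Longrightarrow> smooth_real (\<lambda>x. f (g x))"
  and smooth_real_inverse: "smooth_real f \<Longrightarrow> (\<And>x. f x \<noteq> 0) \<Longrightarrow> smooth_real (\<lambda>x. inverse (f x))"
  by (simp_all add: smooth_real_def k_times_differentiable_add k_times_differentiable_mult
      k_times_differentiable_compose k_times_differentiable_inverse)

lemma smooth_real_power: "smooth_real f \<Longrightarrow> smooth_real (\<lambda>x. f x ^ n)"
  by (induction n) (auto intro: smooth_real_const smooth_real_mult)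

lemmas smooth_real_intros = smooth_real_ident smooth_real_const smooth_real_add smooth_real_mult
  smooth_real_power

lemma smooth_real_has_derivative:
  assumes "smooth_real h"
  shows "(h has_real_derivative deriv h x) (at x)"
proof -
  have "k_times_differentiable (Suc 0) h" using assms unfolding smooth_real_def by blast
  then obtain h' where "\<forall>x. (h has_real_derivative h' x) (at x)" by auto
  then show ?thesis by (metis DERIV_imp_deriv)
qed

lemma smooth_real_deriv:
  assumes "smooth_real h"
  shows "smooth_real (deriv h)"
  unfolding smooth_real_def
proof
  fix k
  have "k_times_differentiable (Suc k) h" using assms unfolding smooth_real_def by blast
  then obtain h' where h': "\<forall>x. (h has_real_derivative h' x) (at x)" "k_times_differentiable k h'"
    by auto
  then have "deriv h = h'" by (metis DERIV_imp_deriv ext)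
  with h' show "k_times_differentiable k (deriv h)" by simp
qed

lemma smooth_real_iterated_deriv: "smooth_real h \<Longrightarrow> smooth_real ((deriv ^^ j) h)"
  by (induction j) (auto intro: smooth_real_deriv)

lemma smooth_real_continuous_on: "smooth_real h \<Longrightarrow> continuous_on S h"
  by (meson DERIV_isCont continuous_at_imp_continuous_on smooth_real_has_derivative)

section \<open>Flat exponentials and cutoff functions of one variable\<close>

text \<open>\<open>flat_exp 0\<close> is the classical flat function. The denominators
  \<open>t ^ n\<close> make the family closed under differentiation up to linear combinations, so
  one induction with \<open>n\<close> arbitrary proves all members smooth.\<close>

definition flat_exp :: "nat \<Rightarrow> real \<Rightarrow> real" where
  "flat_exp n t = (if t > 0 then exp (- 1 / t) / t ^ n else 0)"

text \<open>Since \<open>flat_exp n 0 = 0\<close>, this is the limit of the difference quotient at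
  the origin. From the right, the substitution of \<open>inverse t\<close> turns it into a power
  divided by an exponential at infinity.\<close>

lemma flat_exp_over_tendsto_0: "((\<lambda>t. flat_exp n t / t) \<longlongrightarrow> 0) (at 0)"
proof (rule filterlim_split_at_real)
  have "((\<lambda>t. inverse t ^ Suc n / exp (inverse t)) \<longlongrightarrow> (0::real)) (at_right 0)"
    by (rule filterlim_compose[OF tendsto_power_div_exp_0 filterlim_inverse_at_top_right])
  then show "((\<lambda>t. flat_exp n t / t) \<longlongrightarrow> 0) (at_right 0)"
    by (rule Lim_transform_eventually)
      (auto simp: eventually_at_right_less flat_exp_def exp_minus field_simps intro!: eventually_mono[OF eventually_at_right_less])
  show "((\<lambda>t. flat_exp n t / t) \<longlongrightarrow> 0) (at_left 0)"
    by (rule Lim_transform_eventually[OF tendsto_const])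
      (auto simp: flat_exp_def eventually_at_filter)
qed

lemma flat_exp_has_derivative:
  "(flat_exp n has_real_derivative flat_exp (n + 2) t + (- real n) * flat_exp (n + 1) t) (at t)"
proof (cases t "0::real" rule: linorder_cases)
  case less
  have "((\<lambda>_. 0) has_real_derivative 0) (at t)" by simp
  then have "(flat_exp n has_real_derivative 0) (at t)"
    by (rule has_field_derivative_transform_within_open[where S = "{..<0}"])
      (use less in \<open>auto simp: flat_exp_def\<close>)
  with less show ?thesis by (simp add: flat_exp_def)
next
  case equal
  show ?thesis using flat_exp_over_tendsto_0[of n] equal
    by (simp add: has_field_derivative_iff flat_exp_def[of _ 0])
next
  case greater
  have "((\<lambda>t. exp (- 1 / t) / t ^ n) has_real_derivative
      flat_exp (n + 2) t + (- real n) * flat_exp (n + 1) t) (at t)"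
    using greater
    by (auto intro!: derivative_eq_intros simp: flat_exp_def field_simps power2_eq_square)
      (cases n; simp)
  then show ?thesis
    by (rule has_field_derivative_transform_within_open[where S = "{0<..}"])
      (use greater in \<open>auto simp: flat_exp_def\<close>)
qed

lemma smooth_real_flat_exp: "smooth_real (flat_exp n)"
  unfolding smooth_real_def
proof
  fix k show "k_times_differentiable k (flat_exp n)"
  proof (induction k arbitrary: n)
    case (Suc k)
    have "k_times_differentiable k (\<lambda>t. flat_exp (n + 2) t + (- real n) * flat_exp (n + 1) t)"
      by (intro k_times_differentiable_add k_times_differentiable_mult
          k_times_differentiable_const Suc)
    then show ?case unfolding k_times_differentiable.simps
      by (intro exI[of _ "\<lambda>t. flat_exp (n + 2) t + (- real n) * flat_exp (n + 1) t"]
          conjI allI flat_exp_has_derivative)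
  qed simp
qed

text \<open>Each differentiation of a power of \<open>h\<close> consumes at most one factor
  \<open>h\<close>; everything else goes into the smooth cofactor \<open>q\<close>. This is the
  source of the bound of derivatives of a cutoff by a power of the cutoff itself.\<close>

lemma iterated_deriv_power_factor:
  assumes "smooth_real h" "j \<le> k"
  shows "\<exists>q. smooth_real q \<and> (deriv ^^ j) (\<lambda>t. h t ^ k) = (\<lambda>t. h t ^ (k - j) * q t)"
  using assms(2)
proof (induction j)
  case 0
  show ?case by (auto intro!: exI[of _ "\<lambda>_. 1"] smooth_real_const)
next
  case (Suc j)
  then obtain q where q: "smooth_real q" "(deriv ^^ j) (\<lambda>t. h t ^ k) = (\<lambda>t. h t ^ (k - j) * q t)"
    by auto
  obtain l where l: "k - j = Suc l" "k - Suc j = l" using Suc.prems by (metis Suc_diff_Suc Suc_le_lessD)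
  let ?q = "\<lambda>t. (1 + real l) * (deriv h t * q t) + h t * deriv q t"
  have "((\<lambda>t. h t ^ Suc l * q t) has_real_derivative h t ^ l * ?q t) (at t)" for t
    using smooth_real_has_derivative[OF assms(1), of t] smooth_real_has_derivative[OF q(1), of t]
    by (auto intro!: derivative_eq_intros simp: algebra_simps) (cases l; simp)
  then have "(deriv ^^ Suc j) (\<lambda>t. h t ^ k) = (\<lambda>t. h t ^ l * ?q t)"
    by (auto simp: q(2) l intro!: ext DERIV_imp_deriv)
  moreover have "smooth_real ?q"
    by (intro smooth_real_intros smooth_real_deriv assms q)
  ultimately show ?case unfolding l by (intro exI[of _ ?q]) auto
qed

text \<open>Applied where the plateau equals 1, this confines derivatives of positive order to the
  outer shell, hence produces the lower bounds on coordinates in \<open>Q_set\<close>.\<close>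

lemma iterated_deriv_eq_0_if_const_on_open:
  fixes h :: "real \<Rightarrow> real"
  assumes "open S" "\<And>t. t \<in> S \<Longrightarrow> h t = c" "j > 0" "t \<in> S"
  shows "(deriv ^^ j) h t = 0"
proof -
  have "\<exists>d. \<forall>t\<in>S. (deriv ^^ i) h t = d \<and> (i > 0 \<longrightarrow> d = 0)" for i
  proof (induction i)
    case (Suc i)
    then obtain d where d: "\<And>t. t \<in> S \<Longrightarrow> (deriv ^^ i) h t = d" by auto
    have "((deriv ^^ i) h has_real_derivative 0) (at t)" if "t \<in> S" for t
      by (rule has_field_derivative_transform_within_open[where S = S and f = "\<lambda>_. d"])
        (use d assms that in auto)
    then show ?case by (auto intro!: exI[of _ 0] DERIV_imp_deriv)
  qed (use assms in auto)
  with assms show ?thesis by metis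
qed

text \<open>The witness is \<open>E(1 - t^2) / (E(1 - t^2) + E(t^2 - 1/4))\<close> with
  \<open>E = flat_exp 0\<close>. The denominator is positive because at least one of the two
  arguments is positive for each \<open>t\<close>.\<close>

lemma ex_smooth_plateau:
  "\<exists>h. smooth_real h \<and> (\<forall>t. 0 \<le> h t \<and> h t \<le> 1) \<and> (\<forall>t. \<bar>t\<bar> \<le> 1/2 \<longrightarrow> h t = 1) \<and> (\<forall>t. \<bar>t\<bar> \<ge> 1 \<longrightarrow> h t = 0)"
proof -
  let ?E = "\<lambda>s. flat_exp 0 s"
  \<comment> \<open>Differences are written as sums with negative constants to match the closure
    rules of \<open>smooth_real\<close>.\<close>
  let ?d = "\<lambda>t. ?E (1 + (-1) * t\<^sup>2) + ?E (t\<^sup>2 + (-1/4))"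
  let ?h = "\<lambda>t. ?E (1 + (-1) * t\<^sup>2) * inverse (?d t)"
  have nonneg: "?E s \<ge> 0" and pos: "s > 0 \<Longrightarrow> ?E s > 0" for s by (auto simp: flat_exp_def)
  have d: "?d t > 0" for t
  proof (cases "t\<^sup>2 < 1")
    case True
    then show ?thesis using pos[of "1 + (-1) * t\<^sup>2"] nonneg[of "t\<^sup>2 + (-1/4)"] by linarith
  next
    case False
    then show ?thesis using pos[of "t\<^sup>2 + (-1/4)"] nonneg[of "1 + (-1) * t\<^sup>2"] by linarith
  qed
  have "smooth_real ?h"
    by (intro smooth_real_mult smooth_real_inverse smooth_real_add smooth_real_intros
        smooth_real_compose[OF smooth_real_flat_exp] less_imp_neq[OF d, symmetric])
  moreover have "0 \<le> ?h t \<and> ?h t \<le> 1" for t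
    using d[of t] nonneg[of "t\<^sup>2 + (-1/4)"] nonneg[of "1 + (-1) * t\<^sup>2"] by (auto simp: field_simps)
  moreover have "?h t = 1" if "\<bar>t\<bar> \<le> 1/2" for t
  proof -
    have "t\<^sup>2 \<le> (1/2)\<^sup>2" using that by (metis abs_ge_zero power2_abs power_mono)
    then have "?E (t\<^sup>2 + (-1/4)) = 0" by (simp add: flat_exp_def power2_eq_square)
    then show ?thesis using d[of t] by simp
  qed
  moreover have "?h t = 0" if "\<bar>t\<bar> \<ge> 1" for t
  proof -
    have "1 \<le> t\<^sup>2" using that by (metis abs_le_square_iff abs_one power_one)
    then show ?thesis by (simp add: flat_exp_def)
  qed
  ultimately show ?thesis by (intro exI[of _ ?h]) blast
qed

text \<open>With \<open>\<eta> = h ^ k\<close> for a plateau \<open>h\<close>, the derivative of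
  order \<open>j\<close> carries the factor \<open>h ^ (k - j)\<close>. For large \<open>k\<close>
  the exponent \<open>k - j\<close> is at least \<open>r * k\<close>, and
  \<open>0 \<le> h \<le> 1\<close> gives domination by \<open>\<eta> powr r\<close>.\<close>

lemma ex_smooth_cutoff:
  fixes r :: real and m :: nat
  assumes r: "0 < r" "r < 1"
  obtains \<eta> C where "smooth_real \<eta>" "\<And>t. 0 \<le> \<eta> t" "\<And>t. \<eta> t \<le> 1"
    "\<And>t. \<bar>t\<bar> \<le> 1/2 \<Longrightarrow> \<eta> t = 1" "\<And>t. \<bar>t\<bar> \<ge> 1 \<Longrightarrow> \<eta> t = 0"
    "\<And>j t. j > 0 \<Longrightarrow> \<bar>t\<bar> < 1/2 \<Longrightarrow> (deriv ^^ j) \<eta> t = 0"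
    "C > 0" "\<And>j t. j \<le> m \<Longrightarrow> \<bar>(deriv ^^ j) \<eta> t\<bar> \<le> C * \<eta> t powr r"
proof -
  obtain h where h: "smooth_real h" "\<And>t. 0 \<le> h t" "\<And>t. h t \<le> 1"
    "\<And>t. \<bar>t\<bar> \<le> 1/2 \<Longrightarrow> h t = 1" "\<And>t. \<bar>t\<bar> \<ge> 1 \<Longrightarrow> h t = 0"
    using ex_smooth_plateau by blast
  \<comment> \<open>The choice amounts to \<open>k - r * k \<ge> m + 1\<close>, which yields both
    \<open>k > m\<close> and \<open>k - j \<ge> r * k\<close> for all
    \<open>j \<le> m\<close>.\<close>
  obtain k :: nat where k: "real k \<ge> (real m + 1) / (1 - r)" using real_arch_simple by blast
  then have kr: "real m + 1 \<le> real k - r * real k" using r by (simp add: field_simps)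
  with r have "real m + 1 \<le> real k" by (smt (verit) mult_nonneg_nonneg of_nat_0_le_iff)
  then have km: "k > m" by linarith
  let ?\<eta> = "\<lambda>t. h t ^ k"
  have "\<exists>C>0. \<forall>t. \<bar>(deriv ^^ j) ?\<eta> t\<bar> \<le> C * ?\<eta> t powr r" if j: "j \<le> m" for j
  proof -
    obtain q where q: "smooth_real q" "(deriv ^^ j) ?\<eta> = (\<lambda>t. h t ^ (k - j) * q t)"
      using iterated_deriv_power_factor[OF h(1), of j k] j km by auto
    \<comment> \<open>The cofactor need only be bounded on \<open>{-1..1}\<close>: for larger
      \<open>\<bar>t\<bar>\<close> the factor \<open>h t ^ (k - j)\<close> is 0, because
      \<open>k > j\<close>.\<close>
    have "compact (q ` {-1..1})"
      by (intro compact_continuous_image smooth_real_continuous_on q) auto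
    then obtain C where C: "C > 0" "\<And>t. t \<in> {-1..1} \<Longrightarrow> \<bar>q t\<bar> \<le> C"
      by (metis bounded_pos compact_imp_bounded image_eqI real_norm_def)
    have "\<bar>h t ^ (k - j) * q t\<bar> \<le> C * (h t ^ k) powr r" for t
    proof (cases "h t = 0")
      case True
      then show ?thesis using km j C by (simp add: zero_power)
    next
      case False
      then have "\<not> \<bar>t\<bar> \<ge> 1" using h(5) by blast
      then have t: "t \<in> {-1..1}" by auto
      have hp: "h t > 0" using False h(2)[of t] by simp
      have "h t ^ (k - j) = h t powr (real k - real j)"
        using hp km j by (simp flip: powr_realpow add: of_nat_diff)
      also have "\<dots> \<le> h t powr (r * real k)"
        using kr j hp h(3)[of t] by (intro powr_mono') auto
      also have "\<dots> = (h t ^ k) powr r"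
        using hp by (simp flip: powr_realpow add: powr_powr mult.commute)
      finally have "h t ^ (k - j) * \<bar>q t\<bar> \<le> (h t ^ k) powr r * C"
        using C(2)[OF t] hp by (intro mult_mono) auto
      then show ?thesis using hp by (simp add: abs_mult mult.commute)
    qed
    with C q(2) show ?thesis by auto
  qed
  then obtain c where c: "\<And>j. j \<le> m \<Longrightarrow> c j > 0"
      "\<And>j t. j \<le> m \<Longrightarrow> \<bar>(deriv ^^ j) ?\<eta> t\<bar> \<le> c j * ?\<eta> t powr r" by metis
  \<comment> \<open>Summing the positive constants gives a single one valid for all orders up to
    \<open>m\<close>.\<close>
  have cs: "c j \<le> (\<Sum>j\<le>m. c j)" if "j \<le> m" for j
    using c(1) that by (intro member_le_sum) (auto intro: less_imp_le)
  show thesis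
  proof
    show "smooth_real ?\<eta>" using h by (intro smooth_real_intros)
    show "(deriv ^^ j) ?\<eta> t = 0" if "j > 0" "\<bar>t\<bar> < 1/2" for j t
      by (rule iterated_deriv_eq_0_if_const_on_open[where S = "{-1/2<..<1/2}" and c = 1])
        (use that h(4) in \<open>auto simp: abs_less_iff\<close>)
    show "(\<Sum>j\<le>m. c j) > 0" using c(1) cs[of 0] by (smt (verit) zero_le)
    show "\<bar>(deriv ^^ j) ?\<eta> t\<bar> \<le> (\<Sum>j\<le>m. c j) * ?\<eta> t powr r" if "j \<le> m" for j t
      using c(2)[OF that] cs[OF that] by (meson mult_right_mono order_trans powr_ge_zero)
  qed (use h km in \<open>auto simp: power_le_one\<close>)
qed

section \<open>Partial derivatives of products of one-variable functions\<close>

lemma iterated_deriv_scale: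
  assumes "smooth_real h"
  shows "(deriv ^^ j) (\<lambda>t. h (t / c)) = (\<lambda>t. (deriv ^^ j) h (t / c) / c ^ j)"
proof (induction j)
  case (Suc j)
  have "((\<lambda>t. (deriv ^^ j) h (t / c) / c ^ j) has_real_derivative (deriv ^^ Suc j) h (t / c) / c ^ Suc j) (at t)" for t
    by (rule DERIV_cong[OF DERIV_cdivide[OF DERIV_chain2[OF
            smooth_real_has_derivative[OF smooth_real_iterated_deriv[OF assms]]
            DERIV_cdivide[OF DERIV_ident]]]]) simp
  then show ?case by (auto simp: Suc intro!: ext DERIV_imp_deriv)
qed simp

lemma pderiv_dir_prod:
  fixes h :: "'n::finite \<Rightarrow> real \<Rightarrow> real"
  assumes "\<And>j. smooth_real (h j)"
  shows "pderiv_dir i (\<lambda>x. \<Prod>j\<in>UNIV. h j (x $ j)) =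
    (\<lambda>x. \<Prod>j\<in>UNIV. (if j = i then deriv (h i) else h j) (x $ j))"
proof
  fix x :: "real^'n"
  let ?P = "\<Prod>j\<in>UNIV - {i}. h j (x $ j)"
  have "(\<Prod>j\<in>UNIV. h j ((x + t *\<^sub>R axis i 1) $ j)) = h i (x $ i + t) * ?P" for t
    by (subst prod.remove[of _ i]) (auto simp: axis_def intro!: prod.cong)
  moreover have "((\<lambda>t. h i (x $ i + t) * ?P) has_real_derivative deriv (h i) (x $ i) * ?P) (at 0)"
    by (rule DERIV_cmult_right, rule DERIV_chain2[THEN DERIV_cong, OF smooth_real_has_derivative[OF assms]])
      (auto intro!: derivative_eq_intros)
  moreover have "(\<Prod>j\<in>UNIV. (if j = i then deriv (h i) else h j) (x $ j)) = deriv (h i) (x $ i) * ?P"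
    by (subst prod.remove[of _ i]) (auto intro!: prod.cong)
  ultimately show "pderiv_dir i (\<lambda>x. \<Prod>j\<in>UNIV. h j (x $ j)) x =
    (\<Prod>j\<in>UNIV. (if j = i then deriv (h i) else h j) (x $ j))"
    by (simp add: pderiv_dir_def DERIV_imp_deriv)
qed

text \<open>Differentiating in direction \<open>i\<close> changes the \<open>i\<close>-th factor
  alone, so the result depends on the list through its counts only. For such products the
  independence of the order of differentiation is thus visible without any symmetry theorem.\<close>

lemma pderiv_list_prod:
  fixes h :: "'n::finite \<Rightarrow> real \<Rightarrow> real"
  assumes "\<And>j. smooth_real (h j)"
  shows "pderiv_list is (\<lambda>x. \<Prod>j\<in>UNIV. h j (x $ j)) =
    (\<lambda>x. \<Prod>j\<in>UNIV. (deriv ^^ count_list is j) (h j) (x $ j))"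
proof (induction "is")
  case (Cons i "is")
  have "pderiv_dir i (\<lambda>x. \<Prod>j\<in>UNIV. (deriv ^^ count_list is j) (h j) (x $ j)) =
    (\<lambda>x. \<Prod>j\<in>UNIV. (if j = i then deriv ((deriv ^^ count_list is i) (h i))
      else (deriv ^^ count_list is j) (h j)) (x $ j))"
    by (rule pderiv_dir_prod) (intro smooth_real_iterated_deriv assms)
  also have "\<dots> = (\<lambda>x. \<Prod>j\<in>UNIV. (deriv ^^ count_list (i # is) j) (h j) (x $ j))"
    by (auto intro!: ext prod.cong)
  finally show ?case by (simp only: pderiv_list.simps Cons)
qed simp

lemma smooth_real_prod_differentiable:
  fixes h :: "'n::finite \<Rightarrow> real \<Rightarrow> real"
  assumes "\<And>j. smooth_real (h j)"
  shows "(\<lambda>x::real^'n. \<Prod>j\<in>UNIV. h j (x $ j)) differentiable (at x)"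
proof -
  have D: "((\<lambda>x::real^'n. h j (x $ j)) has_derivative (\<lambda>y. y $ j * deriv (h j) (x $ j))) (at x)" for j
    by (rule DERIV_compose_FDERIV[OF smooth_real_has_derivative[OF assms]])
      (intro bounded_linear.has_derivative[OF bounded_linear_vec_nth] has_derivative_ident)
  show ?thesis using has_derivative_prod[of UNIV "\<lambda>j x. h j (x $ j)", OF D] unfolding differentiable_def by blast
qed

lemma smooth_fun_prod:
  fixes h :: "'n::finite \<Rightarrow> real \<Rightarrow> real"
  assumes "\<And>j. smooth_real (h j)"
  shows "smooth_fun (\<lambda>x. \<Prod>j\<in>UNIV. h j (x $ j))"
  unfolding smooth_fun_def pderiv_list_prod[OF assms]
  by (auto intro!: differentiable_at_imp_differentiable_on smooth_real_prod_differentiable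
      smooth_real_iterated_deriv assms)

text \<open>This makes the \<open>SOME\<close> in \<open>pderiv_mi\<close> meaningful; by
  \<open>pderiv_list_prod\<close> any choice gives the same derivative of a product.\<close>

lemma ex_list_with_counts:
  fixes \<alpha> :: "'n::finite \<Rightarrow> nat"
  shows "\<exists>is. \<forall>i. count_list is i = \<alpha> i"
proof -
  have rep: "count_list (replicate n j) i = (if i = j then n else 0)" for n and i j :: 'n
    by (induction n) auto
  have "\<exists>is. \<forall>i. count_list is i = (if i \<in> S then \<alpha> i else 0)" for S
  proof (induction S rule: finite_induct[OF finite])
    case 1
    show ?case by (auto intro: exI[of _ "[]"])
  next
    case (2 j S)
    then obtain "is" where "\<forall>i. count_list is i = (if i \<in> S then \<alpha> i else 0)" by blast
    then show ?case using 2 by (intro exI[of _ "replicate (\<alpha> j) j @ is"]) (auto simp: rep)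
  qed
  from this[of UNIV] show ?thesis by simp
qed

lemma pderiv_mi_prod:
  fixes h :: "'n::finite \<Rightarrow> real \<Rightarrow> real"
  assumes "\<And>j. smooth_real (h j)"
  shows "pderiv_mi \<alpha> (\<lambda>x. \<Prod>j\<in>UNIV. h j (x $ j)) = (\<lambda>x. \<Prod>j\<in>UNIV. (deriv ^^ \<alpha> j) (h j) (x $ j))"
  using someI_ex[OF ex_list_with_counts[of \<alpha>]] by (simp add: pderiv_mi_def pderiv_list_prod[OF assms])

lemma finite_mi_order_le: "finite {\<alpha>::'n::finite \<Rightarrow> nat. mi_order \<alpha> \<le> m}"
proof (rule finite_subset)
  have "\<alpha> i \<le> mi_order \<alpha>" for \<alpha> :: "'n \<Rightarrow> nat" and i
    unfolding mi_order_def by (rule member_le_sum) auto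
  then show "{\<alpha>::'n \<Rightarrow> nat. mi_order \<alpha> \<le> m} \<subseteq> PiE UNIV (\<lambda>_. {..m})"
    by (auto intro: order_trans)
qed (auto intro: finite_PiE)

text \<open>The test function is the product of the \<open>\<eta> (x $ i / \<rho> i)\<close>.
  Rescaling produces the powers of \<open>\<rho> i\<close>, and the one-variable bounds by
  \<open>\<eta> powr r\<close> multiply to a bound by the same power of the product. The constant
  depends on neither \<open>\<rho>\<close> nor \<open>\<alpha>\<close>, which is what makes
  estimates uniform in \<open>R\<close> possible.\<close>

lemma ex_test_fun_box:
  fixes m :: nat and r :: real
  assumes r: "0 < r" "r < 1"
  obtains C :: real and \<phi> :: "('n::finite \<Rightarrow> real) \<Rightarrow> real^'n \<Rightarrow> real" where "C > 0"
    "\<And>\<rho>. (\<And>i. \<rho> i > 0) \<Longrightarrow> test_fun (\<phi> \<rho>)"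
    "\<And>\<rho> x. 0 \<le> \<phi> \<rho> x" "\<And>\<rho> x. \<phi> \<rho> x \<le> 1"
    "\<And>\<rho> x. (\<And>i. \<rho> i > 0) \<Longrightarrow> (\<And>i. \<bar>x $ i\<bar> \<le> \<rho> i / 2) \<Longrightarrow> \<phi> \<rho> x = 1"
    "\<And>\<rho> \<alpha> x. (\<And>i. \<rho> i > 0) \<Longrightarrow> mi_order \<alpha> \<le> m \<Longrightarrow> \<bar>pderiv_mi \<alpha> (\<phi> \<rho>) x\<bar> \<le>
       C * (\<Prod>i\<in>UNIV. \<rho> i powr - real (\<alpha> i)) * \<phi> \<rho> x powr r *
       indicator {x. \<forall>i. \<bar>x $ i\<bar> \<le> \<rho> i \<and> (\<alpha> i \<noteq> 0 \<longrightarrow> \<bar>x $ i\<bar> \<ge> \<rho> i / 2)} x"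
proof -
  obtain \<eta> C where \<eta>: "smooth_real \<eta>" "\<And>t. 0 \<le> \<eta> t" "\<And>t. \<eta> t \<le> 1"
    "\<And>t. \<bar>t\<bar> \<le> 1/2 \<Longrightarrow> \<eta> t = 1" "\<And>t. \<bar>t\<bar> \<ge> 1 \<Longrightarrow> \<eta> t = 0"
    "\<And>j t. j > 0 \<Longrightarrow> \<bar>t\<bar> < 1/2 \<Longrightarrow> (deriv ^^ j) \<eta> t = 0"
    "C > 0" "\<And>j t. j \<le> m \<Longrightarrow> \<bar>(deriv ^^ j) \<eta> t\<bar> \<le> C * \<eta> t powr r"
    using ex_smooth_cutoff[OF r, of m] by blast
  let ?\<phi> = "\<lambda>(\<rho>::'n \<Rightarrow> real) x. \<Prod>i\<in>UNIV. \<eta> (x $ i / \<rho> i)"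
  have sm: "smooth_real (\<lambda>t. \<eta> (t / c))" for c
    unfolding divide_inverse by (intro smooth_real_compose[OF \<eta>(1)] smooth_real_intros)
  have out: "?\<phi> \<rho> x = 0" if "\<And>i. \<rho> i > 0" "\<bar>x $ i\<bar> > \<rho> i" for \<rho> x i
  proof -
    have "\<eta> (x $ i / \<rho> i) = 0" using that(1)[of i] that(2) by (intro \<eta>) (auto simp: field_simps)
    then show ?thesis by (auto intro: prod_zero)
  qed
  show thesis
  proof
    show "C ^ CARD('n) > 0" using \<eta>(7) by simp
    show "test_fun (?\<phi> \<rho>)" if "\<And>i. \<rho> i > 0" for \<rho>
      unfolding test_fun_def
    proof (intro conjI exI allI impI)
      show "smooth_fun (?\<phi> \<rho>)" by (intro smooth_fun_prod sm)
      show "compact (cbox (\<chi> i. - \<rho> i) (\<chi> i. \<rho> i))" by simp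
      fix x assume "x \<notin> cbox (\<chi> i. - \<rho> i) (\<chi> i. \<rho> i)"
      then obtain i where "\<not> (- \<rho> i \<le> x $ i \<and> x $ i \<le> \<rho> i)" by (auto simp: mem_box_cart)
      then have "\<bar>x $ i\<bar> > \<rho> i" by linarith
      then show "?\<phi> \<rho> x = 0" using out that by blast
    qed
    show "0 \<le> ?\<phi> \<rho> x" "?\<phi> \<rho> x \<le> 1" for \<rho> x using \<eta>(2,3) by (auto intro: prod_nonneg prod_le_1)
    show "?\<phi> \<rho> x = 1" if \<rho>: "\<And>i. \<rho> i > 0" and x: "\<And>i. \<bar>x $ i\<bar> \<le> \<rho> i / 2" for \<rho> x
    proof (intro prod.neutral ballI \<eta>)
      fix i show "\<bar>x $ i / \<rho> i\<bar> \<le> 1/2" using \<rho>[of i] x[of i] by (simp add: field_simps)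
    qed
    fix \<rho> :: "'n \<Rightarrow> real" and \<alpha> :: "'n \<Rightarrow> nat" and x :: "real^'n"
    assume \<rho>: "\<And>i. \<rho> i > 0" and \<alpha>: "mi_order \<alpha> \<le> m"
    have \<alpha>m: "\<alpha> i \<le> m" for i
      using \<alpha> member_le_sum[of i UNIV \<alpha>] unfolding mi_order_def by simp
    let ?Q = "{x. \<forall>i. \<bar>x $ i\<bar> \<le> \<rho> i \<and> (\<alpha> i \<noteq> 0 \<longrightarrow> \<bar>x $ i\<bar> \<ge> \<rho> i / 2)}"
    have D: "pderiv_mi \<alpha> (?\<phi> \<rho>) x = (\<Prod>i\<in>UNIV. (deriv ^^ \<alpha> i) \<eta> (x $ i / \<rho> i) / \<rho> i ^ \<alpha> i)"
      by (simp add: pderiv_mi_prod[OF sm] iterated_deriv_scale[OF \<eta>(1)])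
    have "pderiv_mi \<alpha> (?\<phi> \<rho>) x = 0" if "x \<notin> ?Q"
    proof -
      from that obtain i where "\<bar>x $ i\<bar> > \<rho> i \<or> \<alpha> i \<noteq> 0 \<and> \<bar>x $ i\<bar> < \<rho> i / 2"
        by (auto simp: not_le)
      then have "(deriv ^^ \<alpha> i) \<eta> (x $ i / \<rho> i) = 0"
      proof
        assume "\<bar>x $ i\<bar> > \<rho> i"
        then have "\<eta> (x $ i / \<rho> i) = 0" using \<rho>[of i] by (intro \<eta>) (auto simp: field_simps)
        \<comment> \<open>Here \<open>\<eta>\<close> vanishes, and the bound of its derivative by a
          multiple of \<open>\<eta> powr r\<close> forces the derivative to vanish too, since
          \<open>0 powr r = 0\<close>.\<close>
        then show ?thesis using \<eta>(8)[OF \<alpha>m[of i], of "x $ i / \<rho> i"] by simp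
      next
        assume "\<alpha> i \<noteq> 0 \<and> \<bar>x $ i\<bar> < \<rho> i / 2"
        then show ?thesis using \<rho>[of i] by (intro \<eta>(6)) (auto simp: field_simps)
      qed
      then show ?thesis unfolding D by (auto intro!: prod_zero)
    qed
    moreover have "\<bar>pderiv_mi \<alpha> (?\<phi> \<rho>) x\<bar> \<le>
      C ^ CARD('n) * (\<Prod>i\<in>UNIV. \<rho> i powr - real (\<alpha> i)) * ?\<phi> \<rho> x powr r"
    proof -
      have "\<bar>pderiv_mi \<alpha> (?\<phi> \<rho>) x\<bar> \<le> (\<Prod>i\<in>UNIV. C * \<rho> i powr - real (\<alpha> i) * \<eta> (x $ i / \<rho> i) powr r)"
        unfolding D abs_prod
      proof (intro prod_mono conjI)
        fix i
        have "\<bar>(deriv ^^ \<alpha> i) \<eta> (x $ i / \<rho> i)\<bar> / \<rho> i ^ \<alpha> i \<le> C * \<eta> (x $ i / \<rho> i) powr r / \<rho> i ^ \<alpha> i"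
          using \<rho>[of i] by (intro divide_right_mono \<eta> \<alpha>m) auto
        then show "\<bar>(deriv ^^ \<alpha> i) \<eta> (x $ i / \<rho> i) / \<rho> i ^ \<alpha> i\<bar>
          \<le> C * \<rho> i powr - real (\<alpha> i) * \<eta> (x $ i / \<rho> i) powr r"
          using \<rho>[of i] by (simp add: powr_minus powr_realpow field_simps)
      qed auto
      also have "\<dots> = C ^ CARD('n) * (\<Prod>i\<in>UNIV. \<rho> i powr - real (\<alpha> i)) * ?\<phi> \<rho> x powr r"
        using \<eta>(2) by (simp add: prod.distrib prod_powr_distrib)
      finally show ?thesis .
    qed
    ultimately show "\<bar>pderiv_mi \<alpha> (?\<phi> \<rho>) x\<bar> \<le> C ^ CARD('n) * (\<Prod>i\<in>UNIV. \<rho> i powr - real (\<alpha> i)) *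
       ?\<phi> \<rho> x powr r * indicator ?Q x"
      by (cases "x \<in> ?Q") auto
  qed
qed

section \<open>Pointwise inequalities and the growth condition\<close>

text \<open>Scale the factors by \<open>s powr (1/p)\<close> and \<open>s powr (-1/p)\<close> before
  applying Young's inequality; the identity \<open>q / p = q - 1\<close> gives the stated exponent.
  The divisors \<open>p\<close> and \<open>q\<close> exceed 1 and are dropped.\<close>

lemma Youngs_inequality_weighted:
  fixes x y s p q :: real
  assumes "p > 1" "q > 1" "1 / p + 1 / q = 1" "s > 0" "x \<ge> 0" "y \<ge> 0"
  shows "x * y \<le> s * x powr p + s powr (- (q - 1)) * y powr q"
proof -
  have e: "q / p = q - 1" using assms by (simp add: field_simps)
  have "x * y = (s powr (1/p) * x) * (s powr (- 1/p) * y)"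
    using assms by (simp add: powr_minus field_simps)
  also have "\<dots> \<le> (s powr (1/p) * x) powr p / p + (s powr (- 1/p) * y) powr q / q"
    using assms by (intro Youngs_inequality) auto
  also have "\<dots> = s * x powr p / p + s powr (- (q - 1)) * y powr q / q"
    using assms e by (simp add: powr_mult powr_powr)
  also have "\<dots> \<le> s * x powr p + s powr (- (q - 1)) * y powr q"
    using assms by (intro add_mono) (auto intro!: divide_le_eq[THEN iffD2] simp: mult_le_cancel_left1 not_less)
  finally show ?thesis .
qed

text \<open>Moving \<open>w powr (1/p) * z powr (1/p)\<close> to the side of \<open>U\<close> makes
  its \<open>p\<close>-th power \<open>w * U powr p * z\<close>, the integrand to be absorbed. The
  compensating \<open>w powr (-1/p)\<close> becomes the weight \<open>w powr (- (q - 1))\<close> in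
  \<open>G_fun\<close>.\<close>

lemma Youngs_inequality_cutoff:
  fixes p q s w U b K z :: real
  assumes "p > 1" "q > 1" "1 / p + 1 / q = 1" "s > 0" "w > 0" "U \<ge> 0" "b \<ge> 0" "K \<ge> 0" "z \<ge> 0"
  shows "U * (b * (K * z powr (1 / p))) \<le>
    s * (w * U powr p * z) + s powr (- (q - 1)) * (K powr q * (b powr q * w powr (- (q - 1))))"
proof -
  have e: "q / p = q - 1" using assms by (simp add: field_simps)
  have "U * (b * (K * z powr (1 / p))) = (w powr (1/p) * U * z powr (1/p)) * (K * b * w powr (- 1/p))"
    using assms by (simp add: powr_minus field_simps)
  also have "\<dots> \<le> s * (w powr (1/p) * U * z powr (1/p)) powr p
      + s powr (- (q - 1)) * (K * b * w powr (- 1/p)) powr q"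
    using assms by (intro Youngs_inequality_weighted) auto
  also have "\<dots> = s * (w * U powr p * z) + s powr (- (q - 1)) * (K powr q * (b powr q * w powr (- (q - 1))))"
    using assms e by (simp add: powr_mult powr_powr)
  finally show ?thesis .
qed

lemma closed_Q_set: "closed (Q_set F \<alpha> R)"
  unfolding Q_set_def
  by (intro closed_Collect_all closed_Collect_conj closed_Collect_imp closed_Collect_le continuous_intros) auto

text \<open>Below a finite bound for the upper limit, \<open>G R\<close> cannot be infinite; raising
  the real inequality to the power \<open>q\<close> removes the root.\<close>

lemma growth_eventually_bounded:
  assumes q: "q > 0" and F: "\<And>i R. R > 0 \<Longrightarrow> F i R > 0"
    and L: "Limsup at_top (\<lambda>R. ennreal (H_fun F \<alpha> R) * enn_powr (G R) (1 / q)) < \<infinity>"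
  shows "\<exists>M. \<forall>\<^sub>F R in at_top. G R < \<infinity> \<and> H_fun F \<alpha> R powr q * enn2real (G R) \<le> M"
proof -
  obtain z where z: "Limsup at_top (\<lambda>R. ennreal (H_fun F \<alpha> R) * enn_powr (G R) (1 / q)) < z" "z < \<infinity>"
    using dense[OF L] by blast
  obtain c where c: "z = ennreal c" "c \<ge> 0" using z(2) by (cases z) auto
  from Limsup_lessD[OF z(1)]
  have "\<forall>\<^sub>F R in at_top. G R < \<infinity> \<and> H_fun F \<alpha> R powr q * enn2real (G R) \<le> c powr q"
    using eventually_gt_at_top[of 0]
  proof eventually_elim
    case (elim R)
    \<comment> \<open>Strict positivity matters: in \<open>ennreal\<close> the product of 0 and
      infinity is 0, so only a positive factor excludes \<open>G R = \<infinity>\<close>.\<close>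
    have H: "H_fun F \<alpha> R > 0" unfolding H_fun_def
      using F[OF elim(2)] by (intro prod_pos) (simp add: less_imp_neq[symmetric])
    have fin: "G R \<noteq> \<infinity>"
    proof
      assume "G R = \<infinity>"
      then show False using elim(1) H by (auto simp: enn_powr_def ennreal_mult_top)
    qed
    then have "H_fun F \<alpha> R * enn2real (G R) powr (1 / q) < c"
      using elim(1) H c by (simp add: enn_powr_def ennreal_mult[symmetric] ennreal_less_iff)
    then have "(H_fun F \<alpha> R * enn2real (G R) powr (1 / q)) powr q \<le> c powr q"
      using H q by (intro powr_mono2) auto
    then show ?case using fin H q by (simp add: powr_mult powr_powr less_top)
  qed
  then show ?thesis ..
qed

theorem theorem2p15:
  fixes p :: real and m :: nat
    and b :: "('n::finite \<Rightarrow> nat) \<Rightarrow> real^'n \<Rightarrow> real"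
    and a :: "('n \<Rightarrow> nat) \<Rightarrow> real^'n \<Rightarrow> real"
    and f g u :: "real^'n \<Rightarrow> real"
    and F :: "'n \<Rightarrow> real \<Rightarrow> real"
  defines "p' \<equiv> p / (p - 1)"
  defines "A \<equiv> {\<alpha>::'n \<Rightarrow> nat. 1 \<le> mi_order \<alpha> \<and> mi_order \<alpha> \<le> m}"
  assumes p_gt1: "p > 1"
    (* L(x,\<nabla>) = \<Sum>_{|\<alpha>|\<le>m} b_\<alpha>(x) \<partial>^\<alpha>, D = g L, D^* = \<Sum>_{1\<le>|\<alpha>|\<le>m} a_\<alpha> \<partial>^\<alpha> is its formal adjoint *)
    and f_Linf: "Linf_loc f" and f_pos: "AE x in lebesgue. f x > 0"
    and g_meas: "g \<in> borel_measurable lebesgue" and g_pos: "AE x in lebesgue. g x > 0"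
    and a_Linf: "\<And>\<alpha>. \<alpha> \<in> A \<Longrightarrow> Linf_loc (a \<alpha>)"
    and adjoint: "\<And>\<psi> \<phi>. test_fun \<psi> \<Longrightarrow> test_fun \<phi> \<Longrightarrow>
        integrable lebesgue (\<lambda>x. \<phi> x * (g x * (\<Sum>\<alpha>\<in>{\<alpha>. mi_order \<alpha> \<le> m}. b \<alpha> x * pderiv_mi \<alpha> \<psi> x)))
      \<and> (\<integral>x. \<phi> x * (g x * (\<Sum>\<alpha>\<in>{\<alpha>. mi_order \<alpha> \<le> m}. b \<alpha> x * pderiv_mi \<alpha> \<psi> x)) \<partial>lebesgue)
        = (\<integral>x. \<psi> x * (\<Sum>\<alpha>\<in>A. a \<alpha> x * pderiv_mi \<alpha> \<phi> x) \<partial>lebesgue)"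
    and u_L1: "L1_loc u"
    and fgu_L1: "L1_loc (\<lambda>x. f x * g x * \<bar>u x\<bar> powr p)"
    and solution: "\<And>\<phi>. test_fun \<phi> \<Longrightarrow>
        (\<integral>x. f x * g x * \<bar>u x\<bar> powr p * \<phi> x \<partial>lebesgue)
        = (\<integral>x. u x * (\<Sum>\<alpha>\<in>A. a \<alpha> x * pderiv_mi \<alpha> \<phi> x) \<partial>lebesgue)"
    and F_mono: "\<And>i. strict_mono_on {0<..} (F i)"
    and F_cont: "\<And>i. continuous_on {0<..} (F i)"
    and F_pos: "\<And>i R. R > 0 \<Longrightarrow> F i R > 0"
    and F_lim: "\<And>i. filterlim (F i) at_top at_top"
    and growth: "\<And>\<alpha>. \<alpha> \<in> A \<Longrightarrow>
        Limsup at_top (\<lambda>R. ennreal (H_fun F \<alpha> R) * enn_powr (G_fun F p' (a \<alpha>) g f \<alpha> R) (1 / p')) < \<infinity>"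
  shows "AE x in lebesgue. u x = 0"
proof -
  have p': "p' > 1" "1 / p + 1 / p' = 1"
    using p_gt1 unfolding p'_def by (auto simp: field_simps)
  have finA: "finite A"
    unfolding A_def by (rule finite_subset[OF _ finite_mi_order_le[of m]]) auto
  define v where "v = (\<lambda>x. f x * g x * \<bar>u x\<bar> powr p)"
  define Q where "Q = (\<lambda>\<alpha> R. Q_set F \<alpha> R)"
  define W where "W = (\<lambda>\<alpha> x. \<bar>a \<alpha> x\<bar> powr p' * (g x * f x) powr (- (p' - 1)))"
  have Q_meas: "Q \<alpha> R \<in> sets lebesgue" for \<alpha> R
    unfolding Q_def by (intro sets_completionI_sets) (simp add: closed_Q_set borel_closed)
  have v_meas: "v \<in> borel_measurable lebesgue" using fgu_L1 unfolding L1_loc_def v_def by blast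
  have f_meas: "f \<in> borel_measurable lebesgue" using f_Linf unfolding Linf_loc_def by blast
  have a_meas: "a \<alpha> \<in> borel_measurable lebesgue" if "\<alpha> \<in> A" for \<alpha>
    using a_Linf[OF that] unfolding Linf_loc_def by blast
  have W_meas: "W \<alpha> \<in> borel_measurable lebesgue" if "\<alpha> \<in> A" for \<alpha>
    unfolding W_def using a_meas[OF that] f_meas g_meas by measurable
  have v_nonneg: "AE x in lebesgue. 0 \<le> v x"
    using f_pos g_pos by eventually_elim (auto simp: v_def)

  \<comment> \<open>Rescaled test functions and the integrals J and T\<close>
  have r: "0 < 1 / p" "1 / p < 1" using p_gt1 by auto
  obtain C :: real and \<Phi> :: "('n \<Rightarrow> real) \<Rightarrow> real^'n \<Rightarrow> real" where C: "C > 0"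
    and \<Phi>: "\<And>\<rho>. (\<And>i. \<rho> i > 0) \<Longrightarrow> test_fun (\<Phi> \<rho>)"
    "\<And>\<rho> x. 0 \<le> \<Phi> \<rho> x" "\<And>\<rho> x. \<Phi> \<rho> x \<le> 1"
    "\<And>\<rho> x. (\<And>i. \<rho> i > 0) \<Longrightarrow> (\<And>i. \<bar>x $ i\<bar> \<le> \<rho> i / 2) \<Longrightarrow> \<Phi> \<rho> x = 1"
    "\<And>\<rho> \<alpha> x. (\<And>i. \<rho> i > 0) \<Longrightarrow> mi_order \<alpha> \<le> m \<Longrightarrow> \<bar>pderiv_mi \<alpha> (\<Phi> \<rho>) x\<bar> \<le>
       C * (\<Prod>i\<in>UNIV. \<rho> i powr - real (\<alpha> i)) * \<Phi> \<rho> x powr (1 / p) *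
       indicator {x. \<forall>i. \<bar>x $ i\<bar> \<le> \<rho> i \<and> (\<alpha> i \<noteq> 0 \<longrightarrow> \<bar>x $ i\<bar> \<ge> \<rho> i / 2)} x"
  proof (rule ex_test_fun_box[OF r, where m = m and 'n = 'n], goal_cases)
    case 1
    show ?case by (rule 1(1)) (fact 1)+
  qed
  \<comment> \<open>\<open>F\<close> is positive only on positive arguments. The maximum makes
    \<open>\<phi> R\<close> a test function for every real \<open>R\<close> and changes nothing for
    \<open>R \<ge> 1\<close>.\<close>
  define \<phi> where "\<phi> R = \<Phi> (\<lambda>i. F i (max R 1))" for R
  have FR: "F i (max R 1) > 0" for i R by (intro F_pos) simp
  have \<phi>_test: "test_fun (\<phi> R)" for R unfolding \<phi>_def by (intro \<Phi> FR)
  have \<phi>_nonneg: "0 \<le> \<phi> R x" and \<phi>_le1: "\<phi> R x \<le> 1" for R x unfolding \<phi>_def by (intro \<Phi>)+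
  have \<phi>_meas: "\<phi> R \<in> borel_measurable lebesgue" for R
  proof -
    have "pderiv_list [] (\<phi> R) differentiable_on UNIV"
      using \<phi>_test unfolding test_fun_def smooth_fun_def by blast
    then have "continuous_on UNIV (\<phi> R)" by (simp add: differentiable_imp_continuous_on)
    then show ?thesis by (simp add: borel_measurable_continuous_onI measurable_completion)
  qed
  have \<phi>_deriv: "\<bar>pderiv_mi \<alpha> (\<phi> R) x\<bar> \<le> C * H_fun F \<alpha> R * \<phi> R x powr (1 / p) * indicator (Q \<alpha> R) x"
    if "\<alpha> \<in> A" "R \<ge> 1" for \<alpha> R x
    using \<Phi>(5)[of "\<lambda>i. F i (max R 1)" \<alpha> x, OF FR] that
    by (simp add: \<phi>_def A_def H_fun_def Q_def Q_set_def)
  have \<phi>_1: "\<forall>\<^sub>F R in at_top. \<phi> R x = 1" for x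
  proof -
    have "\<forall>\<^sub>F R in at_top. \<forall>i. 2 * \<bar>x $ i\<bar> \<le> F i R"
      using F_lim by (intro eventually_all_finite) (auto simp: filterlim_at_top)
    then show ?thesis using eventually_ge_at_top[of 1]
    proof eventually_elim
      case (elim R)
      then show ?case unfolding \<phi>_def by (intro \<Phi> FR) (simp add: max_def mult.commute)
    qed
  qed
  have v\<phi>_int: "integrable lebesgue (\<lambda>x. v x * \<phi> R x)" for R
  proof -
    obtain K where K: "compact K" "\<And>x. x \<notin> K \<Longrightarrow> \<phi> R x = 0"
      using \<phi>_test unfolding test_fun_def by blast
    have "set_integrable lebesgue K v" using fgu_L1 K unfolding L1_loc_def v_def by blast
    then show ?thesis unfolding set_integrable_def
    proof (rule Bochner_Integration.integrable_bound)
      show "AE x in lebesgue. norm (v x * \<phi> R x) \<le> norm (indicator K x *\<^sub>R v x)"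
        using K(2) \<phi>_nonneg \<phi>_le1 by (auto simp: indicator_def abs_mult mult_left_le)
    qed (use v_meas \<phi>_meas in measurable)
  qed
  \<comment> \<open>\<open>T\<close> is the portion of \<open>J\<close> over the region that can
    carry the derivative of index \<open>\<alpha>\<close>. It is first absorbed by \<open>J\<close>
    and later shown to vanish as \<open>R\<close> grows.\<close>
  define J where "J R = (\<integral>x. v x * \<phi> R x \<partial>lebesgue)" for R
  define T where "T \<alpha> R = (\<integral>x. v x * \<phi> R x * indicator (Q \<alpha> R) x \<partial>lebesgue)" for \<alpha> R
  have v\<phi>Q_int: "integrable lebesgue (\<lambda>x. v x * \<phi> R x * indicator (Q \<alpha> R) x)" for R \<alpha>
    by (intro integrable_real_mult_indicator Q_meas v\<phi>_int)
  have T_le_J: "T \<alpha> R \<le> J R" for \<alpha> R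
    unfolding T_def J_def using v_nonneg \<phi>_nonneg
    by (intro integral_mono_AE v\<phi>Q_int v\<phi>_int) (auto elim!: eventually_mono simp: indicator_def)
  have J_nonneg: "0 \<le> J R" for R
    unfolding J_def using v_nonneg \<phi>_nonneg by (intro integral_nonneg_AE) (auto elim!: eventually_mono)

  \<comment> \<open>The integral estimate with a free parameter\<close>
  have "\<forall>\<alpha>\<in>A. \<exists>M. \<forall>\<^sub>F R in at_top. G_fun F p' (a \<alpha>) g f \<alpha> R < \<infinity> \<and>
      H_fun F \<alpha> R powr p' * enn2real (G_fun F p' (a \<alpha>) g f \<alpha> R) \<le> M"
    by (intro ballI growth_eventually_bounded[OF _ F_pos growth]) (use p' in auto)
  from bchoice[OF this] obtain M where M: "\<forall>\<alpha>\<in>A. \<forall>\<^sub>F R in at_top. G_fun F p' (a \<alpha>) g f \<alpha> R < \<infinity> \<and>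
      H_fun F \<alpha> R powr p' * enn2real (G_fun F p' (a \<alpha>) g f \<alpha> R) \<le> M \<alpha>" ..
  define B where "B = C powr p' * (\<Sum>\<alpha>\<in>A. M \<alpha>)"
  have good: "\<forall>\<^sub>F R in at_top. R \<ge> 1 \<and> (\<forall>\<alpha>\<in>A. G_fun F p' (a \<alpha>) g f \<alpha> R < \<infinity> \<and>
      H_fun F \<alpha> R powr p' * enn2real (G_fun F p' (a \<alpha>) g f \<alpha> R) \<le> M \<alpha>)"
    by (intro eventually_conj eventually_ge_at_top eventually_ball_finite finA M)
  \<comment> \<open>The admissible range of \<open>R\<close> comes from \<open>good\<close> and does
    not depend on \<open>s\<close>, so the quantifier over \<open>s\<close> can stand inside;
    neither does \<open>B\<close> depend on \<open>R\<close> or \<open>s\<close>.\<close>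
  have core: "\<forall>\<^sub>F R in at_top. \<forall>s>0. J R \<le> s * (\<Sum>\<alpha>\<in>A. T \<alpha> R) + s powr (- (p' - 1)) * B"
    using good
  proof (eventually_elim, intro allI impI)
    fix R s :: real
    assume R: "R \<ge> 1 \<and> (\<forall>\<alpha>\<in>A. G_fun F p' (a \<alpha>) g f \<alpha> R < \<infinity> \<and>
      H_fun F \<alpha> R powr p' * enn2real (G_fun F p' (a \<alpha>) g f \<alpha> R) \<le> M \<alpha>)" and s: "s > 0"
    let ?K = "\<lambda>\<alpha>. C * H_fun F \<alpha> R"
    have H: "H_fun F \<alpha> R \<ge> 0" for \<alpha> unfolding H_fun_def by (intro prod_nonneg) auto
    have W_int: "has_bochner_integral lebesgue (\<lambda>x. W \<alpha> x * indicator (Q \<alpha> R) x)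
        (enn2real (G_fun F p' (a \<alpha>) g f \<alpha> R))" if "\<alpha> \<in> A" for \<alpha>
    proof (rule has_bochner_integral_nn_integral)
      have "(\<integral>\<^sup>+ x. ennreal (W \<alpha> x * indicator (Q \<alpha> R) x) \<partial>lebesgue) = G_fun F p' (a \<alpha>) g f \<alpha> R"
        unfolding G_fun_def W_def Q_def
        by (intro nn_integral_cong) (auto simp: indicator_def)
      then show "(\<integral>\<^sup>+ x. ennreal (W \<alpha> x * indicator (Q \<alpha> R) x) \<partial>lebesgue) =
          ennreal (enn2real (G_fun F p' (a \<alpha>) g f \<alpha> R))"
        using R that by (simp add: ennreal_enn2real less_top)
      show "(\<lambda>x. W \<alpha> x * indicator (Q \<alpha> R) x) \<in> borel_measurable lebesgue"
        by (intro borel_measurable_times borel_measurable_indicator W_meas that Q_meas)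
    qed (auto simp: W_def)
    let ?b = "\<lambda>x. \<Sum>\<alpha>\<in>A. s * (v x * \<phi> R x * indicator (Q \<alpha> R) x)
        + s powr (- (p' - 1)) * (?K \<alpha> powr p' * (W \<alpha> x * indicator (Q \<alpha> R) x))"
    have b: "has_bochner_integral lebesgue ?b (\<Sum>\<alpha>\<in>A. s * T \<alpha> R
        + s powr (- (p' - 1)) * (?K \<alpha> powr p' * enn2real (G_fun F p' (a \<alpha>) g f \<alpha> R)))"
      unfolding T_def
      by (intro has_bochner_integral_sum has_bochner_integral_add has_bochner_integral_mult_right
          W_int has_bochner_integral_integrable v\<phi>Q_int)
    have "J R = (\<integral>x. u x * (\<Sum>\<alpha>\<in>A. a \<alpha> x * pderiv_mi \<alpha> (\<phi> R) x) \<partial>lebesgue)"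
      unfolding J_def v_def by (rule solution[OF \<phi>_test])
    also have "\<dots> \<le> (\<integral>x. ?b x \<partial>lebesgue)"
    \<comment> \<open>This rule asks for integrability of the nonnegative majorant \<open>?b\<close>
      only: if the left integrand is not integrable, its integral has the default value 0.\<close>
    proof (rule integral_mono_AE')
      show "integrable lebesgue ?b" using b by (rule integrable.intros)
      show "AE x in lebesgue. 0 \<le> ?b x" using v_nonneg
      proof eventually_elim
        case (elim x)
        then show ?case using s \<phi>_nonneg
          by (intro sum_nonneg add_nonneg_nonneg mult_nonneg_nonneg) (auto simp: W_def)
      qed
      show "AE x in lebesgue. u x * (\<Sum>\<alpha>\<in>A. a \<alpha> x * pderiv_mi \<alpha> (\<phi> R) x) \<le> ?b x"
        using f_pos g_pos
      proof eventually_elim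
        case (elim x)
        have w: "g x * f x > 0" using elim by simp
        have "u x * (a \<alpha> x * pderiv_mi \<alpha> (\<phi> R) x) \<le> s * (v x * \<phi> R x * indicator (Q \<alpha> R) x)
          + s powr (- (p' - 1)) * (?K \<alpha> powr p' * (W \<alpha> x * indicator (Q \<alpha> R) x))" if \<alpha>: "\<alpha> \<in> A" for \<alpha>
        proof -
          have "u x * (a \<alpha> x * pderiv_mi \<alpha> (\<phi> R) x) \<le> \<bar>u x\<bar> * (\<bar>a \<alpha> x\<bar> * \<bar>pderiv_mi \<alpha> (\<phi> R) x\<bar>)"
            by (simp flip: abs_mult)
          also have "\<dots> \<le> \<bar>u x\<bar> * (\<bar>a \<alpha> x\<bar> * (?K \<alpha> * \<phi> R x powr (1 / p) * indicator (Q \<alpha> R) x))"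
            using R by (intro mult_left_mono \<phi>_deriv \<alpha>) auto
          also have "\<dots> = \<bar>u x\<bar> * (\<bar>a \<alpha> x\<bar> * (?K \<alpha> * \<phi> R x powr (1 / p))) * indicator (Q \<alpha> R) x"
            by simp
          \<comment> \<open>\<open>Youngs_inequality_cutoff\<close> is used under the indicator with
            \<open>w = g x * f x\<close>, \<open>U = \<bar>u x\<bar>\<close>,
            \<open>b = \<bar>a \<alpha> x\<bar>\<close>, \<open>K = C * H_fun F \<alpha> R\<close>
            and \<open>z = \<phi> R x\<close>.\<close>
          also have "\<dots> \<le> (s * (g x * f x * \<bar>u x\<bar> powr p * \<phi> R x) + s powr (- (p' - 1)) *
              (?K \<alpha> powr p' * (\<bar>a \<alpha> x\<bar> powr p' * (g x * f x) powr (- (p' - 1))))) * indicator (Q \<alpha> R) x"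
            using p_gt1 p' s w C H \<phi>_nonneg by (intro mult_right_mono Youngs_inequality_cutoff) auto
          also have "\<dots> = s * (v x * \<phi> R x * indicator (Q \<alpha> R) x)
              + s powr (- (p' - 1)) * (?K \<alpha> powr p' * (W \<alpha> x * indicator (Q \<alpha> R) x))"
            by (simp add: v_def W_def algebra_simps)
          finally show ?thesis .
        qed
        then show ?case unfolding sum_distrib_left by (rule sum_mono)
      qed
    qed
    also have "\<dots> = (\<Sum>\<alpha>\<in>A. s * T \<alpha> R
        + s powr (- (p' - 1)) * (?K \<alpha> powr p' * enn2real (G_fun F p' (a \<alpha>) g f \<alpha> R)))"
      using b by (rule has_bochner_integral_integral_eq)
    also have "\<dots> \<le> (\<Sum>\<alpha>\<in>A. s * T \<alpha> R + s powr (- (p' - 1)) * (C powr p' * M \<alpha>))"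
    proof (intro sum_mono add_left_mono mult_left_mono)
      fix \<alpha> assume "\<alpha> \<in> A"
      then show "?K \<alpha> powr p' * enn2real (G_fun F p' (a \<alpha>) g f \<alpha> R) \<le> C powr p' * M \<alpha>"
        using R C H by (auto simp: powr_mult mult.assoc intro!: mult_left_mono)
    qed auto
    also have "\<dots> = s * (\<Sum>\<alpha>\<in>A. T \<alpha> R) + s powr (- (p' - 1)) * B"
      by (simp add: B_def sum.distrib sum_distrib_left)
    finally show "J R \<le> s * (\<Sum>\<alpha>\<in>A. T \<alpha> R) + s powr (- (p' - 1)) * B" .
  qed

  \<comment> \<open>Absorption and global integrability of v\<close>
  obtain D where D: "\<forall>\<^sub>F R in at_top. J R \<le> D"
  proof
    let ?n = "real (card A)"
    \<comment> \<open>Each of the \<open>?n\<close> terms \<open>T \<alpha> R\<close> is at most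
      \<open>J R\<close>, so this \<open>?s\<close> makes their contribution at most
      \<open>J R / 2\<close>; the added 1 keeps the denominator positive when \<open>A\<close> is
      empty.\<close>
    let ?s = "1 / (2 * (?n + 1))"
    show "\<forall>\<^sub>F R in at_top. J R \<le> 2 * (?s powr (- (p' - 1)) * B)"
      using core
    proof eventually_elim
      case (elim R)
      have "(\<Sum>\<alpha>\<in>A. T \<alpha> R) \<le> ?n * J R" using T_le_J by (rule sum_bounded_above)
      also have "\<dots> \<le> (?n + 1) * J R" using J_nonneg by (intro mult_right_mono) auto
      finally have "?s * (\<Sum>\<alpha>\<in>A. T \<alpha> R) \<le> ?s * ((?n + 1) * J R)" by (intro mult_left_mono) auto
      also have "\<dots> = J R / 2" by (simp add: field_simps)
      finally have "?s * (\<Sum>\<alpha>\<in>A. T \<alpha> R) \<le> J R / 2" .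
      moreover have "J R \<le> ?s * (\<Sum>\<alpha>\<in>A. T \<alpha> R) + ?s powr (- (p' - 1)) * B"
        by (rule elim[rule_format]) simp
      ultimately show ?case by linarith
    qed
  qed

  \<comment> \<open>Fatou's lemma along the integers: at each point \<open>\<phi> (real n)\<close>
    is eventually 1, and the integrals \<open>J (real n)\<close> are eventually at most
    \<open>D\<close>.\<close>
  have v_int: "integrable lebesgue v"
  proof (rule integrableI_nonneg[OF v_meas v_nonneg])
    have "(\<integral>\<^sup>+ x. ennreal (v x) \<partial>lebesgue) = (\<integral>\<^sup>+ x. liminf (\<lambda>n. ennreal (v x * \<phi> (real n) x)) \<partial>lebesgue)"
    proof (rule nn_integral_cong)
      fix x
      have "(\<lambda>n. ennreal (v x * \<phi> (real n) x)) \<longlonglongrightarrow> ennreal (v x)"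
        using eventually_compose_filterlim[OF \<phi>_1[of x] filterlim_real_sequentially]
        by (auto intro!: tendsto_eventually elim!: eventually_mono)
      then show "ennreal (v x) = liminf (\<lambda>n. ennreal (v x * \<phi> (real n) x))"
        by (simp add: lim_imp_Liminf)
    qed
    also have "\<dots> \<le> liminf (\<lambda>n. \<integral>\<^sup>+ x. ennreal (v x * \<phi> (real n) x) \<partial>lebesgue)"
      using v_meas \<phi>_meas by (intro nn_integral_liminf) measurable
    also have "\<dots> = liminf (\<lambda>n. ennreal (J (real n)))"
      unfolding J_def using v_nonneg \<phi>_nonneg
      by (intro arg_cong[where f = liminf] ext nn_integral_eq_integral v\<phi>_int) (auto elim!: eventually_mono)
    also have "\<dots> \<le> limsup (\<lambda>n. ennreal (J (real n)))" by (intro Liminf_le_Limsup) simp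
    also have "\<dots> \<le> ennreal D"
      using eventually_compose_filterlim[OF D filterlim_real_sequentially]
      by (intro Limsup_bounded) (auto elim!: eventually_mono intro: ennreal_leI)
    finally show "(\<integral>\<^sup>+ x. ennreal (v x) \<partial>lebesgue) < \<infinity>"
      by (metis ennreal_less_top infinity_ennreal_def order_le_less_trans)
  qed

  \<comment> \<open>The limits in R and then in s\<close>
  have J_lim: "(J \<longlongrightarrow> (\<integral>x. v x \<partial>lebesgue)) at_top"
    unfolding J_def
  proof (rule integral_dominated_convergence_at_top[where w = "\<lambda>x. \<bar>v x\<bar>"])
    show "AE x in lebesgue. ((\<lambda>R. v x * \<phi> R x) \<longlongrightarrow> v x) at_top"
      using \<phi>_1 by (auto intro!: AE_I2 tendsto_eventually elim!: eventually_mono)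
    show "\<forall>\<^sub>F R in at_top. AE x in lebesgue. norm (v x * \<phi> R x) \<le> \<bar>v x\<bar>"
      using \<phi>_nonneg \<phi>_le1 by (auto intro!: always_eventually AE_I2 simp: abs_mult mult_left_le)
  qed (use v_int v_meas \<phi>_meas in \<open>auto intro!: borel_measurable_times\<close>)
  \<comment> \<open>Some \<open>\<alpha> i\<close> is nonzero, so membership in
    \<open>Q \<alpha> R\<close> forces \<open>\<bar>x $ i\<bar> \<ge> F i R / 2\<close>. Every fixed
    point therefore leaves these sets, and \<open>\<bar>v\<bar>\<close> dominates.\<close>
  have T_lim: "(T \<alpha> \<longlongrightarrow> 0) at_top" if "\<alpha> \<in> A" for \<alpha>
  proof -
    have "mi_order \<alpha> \<noteq> 0" using that unfolding A_def by auto
    then obtain i where i: "\<alpha> i \<noteq> 0" unfolding mi_order_def by (auto simp: sum_eq_0_iff)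
    have "((\<lambda>R. \<integral>x. v x * \<phi> R x * indicator (Q \<alpha> R) x \<partial>lebesgue) \<longlongrightarrow> (\<integral>x. (0::real) \<partial>(lebesgue::(real^'n) measure))) at_top"
    proof (rule integral_dominated_convergence_at_top[where w = "\<lambda>x. \<bar>v x\<bar>"])
      show "AE x in lebesgue. ((\<lambda>R. v x * \<phi> R x * indicator (Q \<alpha> R) x) \<longlongrightarrow> 0) at_top"
      proof (intro AE_I2 tendsto_eventually)
        fix x :: "real^'n"
        have "\<forall>\<^sub>F R in at_top. F i R > 2 * \<bar>x $ i\<bar>" using F_lim[of i] by (auto simp: filterlim_at_top_dense)
        then show "\<forall>\<^sub>F R in at_top. v x * \<phi> R x * indicator (Q \<alpha> R) x = 0"
          by eventually_elim (use i in \<open>auto simp: Q_def Q_set_def indicator_def; force\<close>)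
      qed
      show "\<forall>\<^sub>F R in at_top. AE x in lebesgue. norm (v x * \<phi> R x * indicator (Q \<alpha> R) x) \<le> \<bar>v x\<bar>"
        using \<phi>_nonneg \<phi>_le1 by (auto intro!: always_eventually AE_I2 simp: abs_mult mult_left_le indicator_def)
    qed (use v_int v_meas \<phi>_meas Q_meas in \<open>auto intro!: borel_measurable_times\<close>)
    then show ?thesis unfolding T_def by simp
  qed
  \<comment> \<open>With \<open>s\<close> fixed, the sum of the \<open>T \<alpha> R\<close> tends to
    0 and only the term with \<open>B\<close> survives; its exponent \<open>- (p' - 1)\<close> is
    negative, so it vanishes as \<open>s\<close> tends to infinity.\<close>
  have le: "(\<integral>x. v x \<partial>lebesgue) \<le> s powr (- (p' - 1)) * B" if s: "s > 0" for s
  proof (rule tendsto_le[OF _ _ J_lim])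
    have "((\<lambda>R. s * (\<Sum>\<alpha>\<in>A. T \<alpha> R) + s powr (- (p' - 1)) * B) \<longlongrightarrow> s * (\<Sum>\<alpha>\<in>A. 0) + s powr (- (p' - 1)) * B) at_top"
      by (intro tendsto_intros T_lim)
    then show "((\<lambda>R. s * (\<Sum>\<alpha>\<in>A. T \<alpha> R) + s powr (- (p' - 1)) * B) \<longlongrightarrow> s powr (- (p' - 1)) * B) at_top"
      by simp
    show "\<forall>\<^sub>F R in at_top. J R \<le> s * (\<Sum>\<alpha>\<in>A. T \<alpha> R) + s powr (- (p' - 1)) * B"
      using core by eventually_elim (use s in auto)
  qed simp
  have "((\<lambda>s. s powr (- (p' - 1)) * B) \<longlongrightarrow> 0) at_top"
    using p' by (intro tendsto_mult_left_zero tendsto_neg_powr filterlim_ident) auto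
  then have "(\<integral>x. v x \<partial>lebesgue) \<le> 0"
    by (rule tendsto_lowerbound[OF _ eventually_mono[OF eventually_gt_at_top le]]) auto
  moreover have "(\<integral>x. v x \<partial>lebesgue) \<ge> 0" using v_nonneg by (rule integral_nonneg_AE)
  ultimately have "AE x in lebesgue. v x = 0"
    using integral_nonneg_eq_0_iff_AE[OF v_int v_nonneg] by simp
  then show ?thesis using f_pos g_pos
    by eventually_elim (auto simp: v_def)
qed

end
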